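(* Let $\mathcal{G}_n$ ($n\ge 1$) be the pseudofractal scale-free web: $\mathcal{G}_1$ is the complete graph on $3$ vertices, and for $n>1$, $\mathcal{G}_n$ is obtained from $\mathcal{G}_{n-1}$ by creating, for each edge $\{u,v\}$ of $\mathcal{G}_{n-1}$, a new vertex joined by edges to both $u$ and $v$. Then for every $n\ge 3$, the edge domination number of $\mathcal{G}_n$ is $$\gamma(\mathcal{G}_n)=3^{\,n-2}.$$
   Context: For a finite simple graph with edge set $\mathcal{E}$, an edge dominating set is a subset $\mathcal{F}\subseteq\mathcal{E}$ such that every edge in $\mathcal{E}\setminus\mathcal{F}$ shares at least one endpoint with some edge of $\mathcal{F}$. The edge domination number is the minimum cardinality of an edge dominating set. (The graph $\mathcal{G}_n$ has $3^n$ edges and $(3^n+3)/2$ vertices.) *)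

theory Defs
  imports Main "HOL-Library.FSet"
begin

record 'v sgraph =
  verts :: "'v set"
  edges :: "'v set set"

definition finite_simple_graph :: "'v sgraph \<Rightarrow> bool" where
  "finite_simple_graph G \<longleftrightarrow>
     finite (verts G) \<and> (\<forall>e\<in>edges G. e \<subseteq> verts G \<and> card e = 2)"

definition complete_graph :: "'v set \<Rightarrow> 'v sgraph" where
  "complete_graph V = \<lparr>verts = V, edges = {{u, v} | u v. u \<in> V \<and> v \<in> V \<and> u \<noteq> v}\<rparr>"

definition edge_dominating_set :: "'v sgraph \<Rightarrow> 'v set set \<Rightarrow> bool" where
  "edge_dominating_set G F \<longleftrightarrow>
     F \<subseteq> edges G \<and> (\<forall>e\<in>edges G - F. \<exists>f\<in>F. e \<inter> f \<noteq> {})"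

definition edge_domination_number :: "'v sgraph \<Rightarrow> nat" where
  "edge_domination_number G = (LEAST k. \<exists>F. edge_dominating_set G F \<and> card F = k)"

(* Mid n {|u, v|} is the vertex attached to the edge {u, v} when the n-th web is formed.
   The generation n is part of the name because an edge stays in the graph and receives
   another new vertex at every later stage. *)
datatype web_vertex = Corner nat | Mid nat "web_vertex fset"

(* Since {u, v} = {v, u}, the second set contains both {u, w} and {v, w} for the new
   vertex w of the edge {u, v}. *)
definition attach_vertices :: "nat \<Rightarrow> web_vertex sgraph \<Rightarrow> web_vertex sgraph" where
  "attach_vertices n G =
     \<lparr>verts = verts G \<union> {Mid n {|u, v|} | u v. {u, v} \<in> edges G},
      edges = edges G \<union> {{u, Mid n {|u, v|}} | u v. {u, v} \<in> edges G}\<rparr>"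

(* The sequence starts at index 1; the value at 0 is a dummy. *)
fun pseudofractal_web :: "nat \<Rightarrow> web_vertex sgraph" where
  "pseudofractal_web 0 = \<lparr>verts = {}, edges = {}\<rparr>"
| "pseudofractal_web (Suc 0) = complete_graph {Corner 0, Corner 1, Corner 2}"
| "pseudofractal_web (Suc (Suc n)) =
     attach_vertices (Suc (Suc n)) (pseudofractal_web (Suc n))"

lemma complete_graph_triangle:
  assumes "distinct [a, b, c]"
  shows "complete_graph {a, b, c} = \<lparr>verts = {a, b, c}, edges = {{a, b}, {a, c}, {b, c}}\<rparr>"
  using assms unfolding complete_graph_def by (auto simp: insert_commute)

lemma web_vertex_generation:
  "Mid k e \<in> verts (pseudofractal_web n) \<Longrightarrow> k \<le> n"
  by (induction n rule: pseudofractal_web.induct)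
     (auto simp: complete_graph_def attach_vertices_def)

lemma attach_vertices_simple_card:
  assumes G: "finite_simple_graph G" and fresh: "\<And>e. Mid n e \<notin> verts G"
  shows "finite_simple_graph (attach_vertices n G)"
    and "card (verts (attach_vertices n G)) = card (verts G) + card (edges G)"
    and "card (edges (attach_vertices n G)) = 3 * card (edges G)"
proof -
  have finV: "finite (verts G)" and E: "\<And>e. e \<in> edges G \<Longrightarrow> e \<subseteq> verts G \<and> card e = 2"
    using G by (auto simp: finite_simple_graph_def)
  have finE: "finite (edges G)"
    using E finV by (meson PowI finite_Pow_iff finite_subset subsetI)
  define w where "w e = Mid n (Abs_fset e)" for e
  have w: "w {u, v} = Mid n {|u, v|}" for u v
    unfolding w_def by (metis bot_fset.rep_eq finsert.rep_eq fset_inverse)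
  have fin_e: "finite e" if "e \<in> edges G" for e
    using E[OF that] by (metis card.infinite zero_neq_numeral)
  have inj: "inj_on w (edges G)"
    by (auto simp: inj_on_def w_def Abs_fset_inject fin_e)
  have pair: "\<exists>u v. e = {u, v} \<and> u \<noteq> v" if "e \<in> edges G" for e
    using E[OF that] by (auto simp: card_2_iff)
  have newV: "{Mid n {|u, v|} | u v. {u, v} \<in> edges G} = w ` edges G" (is "?N = _")
    using pair by (force simp: w[symmetric])
  have newE: "{{u, Mid n {|u, v|}} | u v. {u, v} \<in> edges G}
      = (\<lambda>(e, u). {u, w e}) ` (SIGMA e:edges G. e)" (is "?M = ?h ` ?S")
  proof
    show "?M \<subseteq> ?h ` ?S"
      by (force simp: w[symmetric])
    show "?h ` ?S \<subseteq> ?M"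
    proof clarify
      fix e u assume eu: "e \<in> edges G" "u \<in> e"
      obtain a b where "e = {a, b}" using pair[OF eu(1)] by blast
      then obtain v where v: "e = {u, v}" using eu(2) by (auto simp: insert_commute)
      show "\<exists>a b. {u, w e} = {a, Mid n {|a, b|}} \<and> {a, b} \<in> edges G"
        using eu(1) by (intro exI[of _ u] exI[of _ v]) (simp add: v w)
    qed
  qed
  have wV: "w e \<notin> verts G" for e
    using fresh by (simp add: w_def)
  have uV: "u \<in> verts G" if "e \<in> edges G" "u \<in> e" for e u
    using E that by blast
  have "card {u, w e} = 2" if "e \<in> edges G" "u \<in> e" for e u
    using uV[OF that] wV[of e] by (auto simp: card_insert_if)
  moreover have "e \<subseteq> verts G \<union> w ` edges G" if "e \<in> edges G" for e
    using E[OF that] by blast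
  ultimately show "finite_simple_graph (attach_vertices n G)"
    unfolding finite_simple_graph_def attach_vertices_def newV newE
    using finV finE E uV by auto
  show "card (verts (attach_vertices n G)) = card (verts G) + card (edges G)"
    unfolding attach_vertices_def newV sgraph.simps
    using wV by (subst card_Un_disjoint) (auto simp: finV finE card_image[OF inj])
  have injh: "inj_on ?h ?S"
  proof (rule inj_onI, clarify)
    fix e u e' u' assume a: "e \<in> edges G" "u \<in> e" "e' \<in> edges G" "u' \<in> e'"
      and eq: "{u, w e} = {u', w e'}"
    have "u \<noteq> w e'" "u' \<noteq> w e" using uV[OF a(1,2)] uV[OF a(3,4)] wV[of e] wV[of e'] by auto
    then have "u = u'" "w e = w e'" using eq by (auto simp: doubleton_eq_iff)
    then show "e = e' \<and> u = u'" using inj a by (auto dest: inj_onD)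
  qed
  have "card ?S = 2 * card (edges G)"
    using finE fin_e E by (subst card_SigmaI) auto
  then have c: "card (?h ` ?S) = 2 * card (edges G)"
    by (simp add: card_image[OF injh])
  have "{u, w e} \<notin> edges G" for u e
    using uV[of "{u, w e}" "w e"] wV[of e] by auto
  then have "edges G \<inter> ?h ` ?S = {}"
    by auto
  moreover have "finite (?h ` ?S)"
    using finE fin_e by auto
  ultimately show "card (edges (attach_vertices n G)) = 3 * card (edges G)"
    unfolding attach_vertices_def newE sgraph.simps
    by (subst card_Un_disjoint) (auto simp: finE c)
qed

lemma pseudofractal_web_simple_card:
  "finite_simple_graph (pseudofractal_web (Suc n)) \<and>
   card (edges (pseudofractal_web (Suc n))) = 3 ^ Suc n \<and>
   2 * card (verts (pseudofractal_web (Suc n))) = 3 ^ Suc n + 3"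
proof (induction n)
  case 0
  show ?case
    by (simp add: complete_graph_triangle finite_simple_graph_def doubleton_eq_iff)
next
  case (Suc n)
  have "Mid (Suc (Suc n)) e \<notin> verts (pseudofractal_web (Suc n))" for e
    using web_vertex_generation by fastforce
  from attach_vertices_simple_card[OF _ this] Suc show ?case
    by simp
qed

end

theory Submission imports Defs begin

text \<open>
  Write \<open>m = n - 2\<close>. The edges of \<open>G\<^sub>n\<close> split into blocks, one for each edge \<open>e\<close> of \<open>G\<^sub>m\<close>.
  The vertex \<open>w\<close> attached to \<open>e\<close> at stage \<open>m + 1\<close> and a vertex \<open>x\<close> attached at stage \<open>n\<close> to an
  edge at \<open>w\<close> have all their incident edges inside the block of \<open>e\<close>, so domination of \<open>{w, x}\<close>
  forces an edge of the dominating set in every block. Conversely, choose an endpoint \<open>c e\<close> of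
  each edge \<open>e\<close> of \<open>G\<^sub>m\<close> such that every vertex of \<open>G\<^sub>m\<close> is chosen: go around the initial
  triangle, and let each new vertex be chosen by one of its edges. The edges joining \<open>c e\<close> to the
  vertex attached to \<open>e\<close> then cover all vertices of \<open>G\<^bsub>n-1\<^esub>\<close>, and these meet every edge of \<open>G\<^sub>n\<close>.
\<close>

section \<open>Vertices and edges added by one attachment step\<close>

text \<open>Naming the new vertex as a function of the edge itself avoids listing the endpoints in
  an order. \<open>Abs_fset\<close> is injective only on finite sets, hence the finiteness
  assumptions in \<open>apex_eq_iff\<close>.\<close>

definition apex :: "nat \<Rightarrow> web_vertex set \<Rightarrow> web_vertex" where
  "apex k e = Mid k (Abs_fset e)"

lemma apex_doubleton: "apex k {u, v} = Mid k {|u, v|}"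
  unfolding apex_def by (metis bot_fset.rep_eq finsert.rep_eq fset_inverse)

lemma apex_eq_iff:
  assumes "finite e" "finite e'"
  shows "apex k e = apex k e' \<longleftrightarrow> e = e'"
  using assms by (simp add: apex_def Abs_fset_inject)

lemma simple_graph_edgeE:
  assumes "finite_simple_graph G" "e \<in> edges G" "u \<in> e"
  obtains v where "e = {u, v}" "u \<noteq> v"
proof -
  have "card e = 2"
    using assms(1,2) by (simp add: finite_simple_graph_def)
  then show thesis
    using assms(3) that by (auto simp: card_2_iff insert_commute)
qed

lemma simple_graph_edge_nonempty:
  "finite_simple_graph G \<Longrightarrow> e \<in> edges G \<Longrightarrow> e \<noteq> {}"
  unfolding finite_simple_graph_def by auto

lemma simple_graph_edge_finite:
  "finite_simple_graph G \<Longrightarrow> e \<in> edges G \<Longrightarrow> finite e"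
  unfolding finite_simple_graph_def by (metis card.infinite zero_neq_numeral)

lemma simple_graph_edge_subset:
  "finite_simple_graph G \<Longrightarrow> e \<in> edges G \<Longrightarrow> e \<subseteq> verts G"
  unfolding finite_simple_graph_def by blast

lemma simple_graph_finite_edges:
  "finite_simple_graph G \<Longrightarrow> finite (edges G)"
  unfolding finite_simple_graph_def by (meson PowI finite_Pow_iff finite_subset subsetI)

lemma verts_attach_vertices:
  assumes "finite_simple_graph G"
  shows "verts (attach_vertices k G) = verts G \<union> apex k ` edges G"
proof -
  have "apex k e \<in> {Mid k {|u, v|} | u v. {u, v} \<in> edges G}" if e: "e \<in> edges G" for e
  proof -
    obtain u where u: "u \<in> e"
      using simple_graph_edge_nonempty[OF assms e] by blast
    obtain v where "e = {u, v}"
      using simple_graph_edgeE[OF assms e u] .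
    then show ?thesis
      using e by (auto simp: apex_doubleton)
  qed
  then show ?thesis
    by (auto simp: attach_vertices_def apex_doubleton[symmetric])
qed

lemma edges_attach_vertices:
  assumes "finite_simple_graph G"
  shows "edges (attach_vertices k G) =
    edges G \<union> {{u, apex k e} | u e. e \<in> edges G \<and> u \<in> e}" (is "_ = _ \<union> ?N")
proof -
  have "{{u, Mid k {|u, v|}} | u v. {u, v} \<in> edges G} = ?N"
  proof
    show "?N \<subseteq> {{u, Mid k {|u, v|}} | u v. {u, v} \<in> edges G}"
    proof clarify
      fix u e assume e: "e \<in> edges G" "u \<in> e"
      obtain v where "e = {u, v}"
        using simple_graph_edgeE[OF assms e] .
      then show "\<exists>a b. {u, apex k e} = {a, Mid k {|a, b|}} \<and> {a, b} \<in> edges G"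
        using e(1) by (intro exI[of _ u] exI[of _ v]) (simp add: apex_doubleton)
    qed
    show "{{u, Mid k {|u, v|}} | u v. {u, v} \<in> edges G} \<subseteq> ?N"
      unfolding apex_doubleton[symmetric] by blast
  qed
  then show ?thesis
    by (simp add: attach_vertices_def)
qed

text \<open>New vertices are joined only to old ones, so an edge contains at most one of them. This
  is what keeps the blocks of distinct edges of \<open>G\<close> apart.\<close>

lemma attach_vertices_edge_apex_unique:
  assumes G: "finite_simple_graph G" and fresh: "\<And>e. Mid k e \<notin> verts G"
    and h: "h \<in> edges (attach_vertices k G)"
    and e: "e \<in> edges G" "apex k e \<in> h" and e': "e' \<in> edges G" "apex k e' \<in> h"
  shows "e = e'"
proof -
  have *: "apex k d \<notin> verts G" for d
    using fresh by (simp add: apex_def)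
  then have "h \<notin> edges G"
    using simple_graph_edge_subset[OF G, of h] e by blast
  then obtain u d where "d \<in> edges G" "u \<in> d" "h = {u, apex k d}"
    using h by (auto simp: edges_attach_vertices[OF G])
  then have "apex k e = apex k d" "apex k e' = apex k d"
    using e e' * simple_graph_edge_subset[OF G, of d] by auto
  then show ?thesis
    using apex_eq_iff simple_graph_edge_finite[OF G] e(1) e'(1) by metis
qed

section \<open>Lower bound\<close>

text \<open>A nonempty edge of \<open>F\<close> meets itself, so edges inside and outside
  \<open>F\<close> can be treated alike.\<close>

lemma edge_dominating_set_meets:
  assumes "edge_dominating_set G F" "g \<in> edges G" "g \<noteq> {}"
  shows "\<exists>f\<in>F. f \<inter> g \<noteq> {}"
  using assms unfolding edge_dominating_set_def by (metis DiffI Int_commute inf.idem)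

lemma edge_dominating_set_lower:
  assumes G: "finite_simple_graph G" and fresh: "\<And>e. Mid j e \<notin> verts G"
    and fresh': "\<And>e. Mid k e \<notin> verts (attach_vertices j G)"
    and F: "edge_dominating_set (attach_vertices k (attach_vertices j G)) F"
  shows "card (edges G) \<le> card F"
proof -
  let ?H = "attach_vertices j G" and ?K = "attach_vertices k (attach_vertices j G)"
  have H: "finite_simple_graph ?H"
    using attach_vertices_simple_card(1)[OF G fresh] .
  have K: "finite_simple_graph ?K"
    using attach_vertices_simple_card(1)[OF H fresh'] .
  have FK: "F \<subseteq> edges ?K"
    using F by (simp add: edge_dominating_set_def)
  obtain c where c: "c e \<in> e" if "e \<in> edges G" for e
    using simple_graph_edge_nonempty[OF G] by (metis ex_in_conv)
  define h where "h e = {c e, apex j e}" for e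
  \<comment> \<open>This is the edge joining the vertex \<open>w\<close> attached to
    \<open>e\<close> to the vertex \<open>x\<close> attached to the edge \<open>h e\<close> at
    \<open>w\<close>.\<close>
  define g where "g e = {apex j e, apex k (h e)}" for e
  have hH: "h e \<in> edges ?H" if "e \<in> edges G" for e
    using that c by (auto simp: h_def edges_attach_vertices[OF G])
  have gK: "g e \<in> edges ?K" if "e \<in> edges G" for e
    using hH[OF that] unfolding g_def h_def edges_attach_vertices[OF H] by blast
  have "\<exists>f\<in>F. f \<inter> g e \<noteq> {}" if "e \<in> edges G" for e
    using edge_dominating_set_meets[OF F gK[OF that]] by (simp add: g_def)
  then obtain d where d: "d e \<in> F" "d e \<inter> g e \<noteq> {}" if "e \<in> edges G" for e
    by metis
  have new: "apex k a \<notin> verts ?H" for a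
    using fresh' by (simp add: apex_def)
  have old: "apex j e \<in> verts ?H" if "e \<in> edges G" for e
    using that by (simp add: verts_attach_vertices[OF G])
  \<comment> \<open>The witness \<open>b\<close> is \<open>f\<close> itself if \<open>f\<close> is
    an edge of \<open>?H\<close>, and otherwise the edge to which the new end of \<open>f\<close> is
    attached. As \<open>b\<close> contains at most one stage-\<open>j\<close> vertex,
    \<open>f\<close> meets \<open>g e\<close> for at most one \<open>e\<close>.\<close>
  have block: "\<exists>b\<in>edges ?H. \<forall>e\<in>edges G. f \<inter> g e \<noteq> {} \<longrightarrow> apex j e \<in> b"
    if f: "f \<in> edges ?K" for f
  proof (cases "f \<in> edges ?H")
    case True
    then show ?thesis
      using new simple_graph_edge_subset[OF H True] by (auto simp: g_def intro!: bexI[of _ f])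
  next
    case False
    then obtain u b where b: "b \<in> edges ?H" "u \<in> b" "f = {u, apex k b}"
      using f by (auto simp: edges_attach_vertices[OF H])
    have u: "u \<in> verts ?H"
      using b simple_graph_edge_subset[OF H] by blast
    have "apex j e \<in> b" if e: "e \<in> edges G" and m: "f \<inter> g e \<noteq> {}" for e
    proof -
      \<comment> \<open>A common vertex is old in both edges or new in both, since
        stage-\<open>k\<close> vertices lie outside \<open>?H\<close>.\<close>
      have "u = apex j e \<or> apex k b = apex k (h e)"
        using m b(3) u new old[OF e] by (auto simp: g_def)
      moreover have "b = h e" if "apex k b = apex k (h e)"
        using that apex_eq_iff simple_graph_edge_finite[OF H] b(1) hH[OF e] by blast
      ultimately show ?thesis
        using b(2) by (auto simp: h_def)
    qed
    then show ?thesis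
      using b(1) by blast
  qed
  have "inj_on d (edges G)"
  proof (rule inj_onI)
    fix e e' assume e: "e \<in> edges G" and e': "e' \<in> edges G" and eq: "d e = d e'"
    obtain b where "b \<in> edges ?H" "\<forall>a\<in>edges G. d e \<inter> g a \<noteq> {} \<longrightarrow> apex j a \<in> b"
      using block d(1)[OF e] FK by blast
    then show "e = e'"
      using attach_vertices_edge_apex_unique[OF G fresh] e e' d(2) eq by metis
  qed
  moreover have "finite F"
    using FK simple_graph_finite_edges[OF K] finite_subset by blast
  ultimately show ?thesis
    using d(1) by (intro card_inj_on_le[of d]) auto
qed

section \<open>Upper bound\<close>

lemma edge_dominating_set_upper:
  assumes G: "finite_simple_graph G" and fresh: "\<And>e. Mid j e \<notin> verts G"
    and c: "\<And>e. e \<in> edges G \<Longrightarrow> c e \<in> e" and surj: "verts G \<subseteq> c ` edges G"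
  shows "edge_dominating_set (attach_vertices k (attach_vertices j G))
           ((\<lambda>e. {c e, apex j e}) ` edges G)" (is "edge_dominating_set ?K ?F")
proof -
  let ?H = "attach_vertices j G"
  have H: "finite_simple_graph ?H"
    using attach_vertices_simple_card(1)[OF G fresh] .
  have FK: "?F \<subseteq> edges ?K"
    using c by (auto simp: edges_attach_vertices[OF G] edges_attach_vertices[OF H])
  have cov: "verts ?H \<subseteq> \<Union>?F"
    using surj by (auto simp: verts_attach_vertices[OF G])
  \<comment> \<open>Even an edge created at stage \<open>k\<close> keeps one end in
    \<open>?H\<close>, so covering \<open>verts ?H\<close> suffices.\<close>
  have meet: "g \<inter> verts ?H \<noteq> {}" if g: "g \<in> edges ?K" for g
  proof -
    obtain b u where "b \<in> edges ?H" "u \<in> b" "u \<in> g"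
      using g simple_graph_edge_nonempty[OF H] unfolding edges_attach_vertices[OF H] by blast
    then show ?thesis
      using simple_graph_edge_subset[OF H] by blast
  qed
  have "\<exists>f\<in>?F. g \<inter> f \<noteq> {}" if g: "g \<in> edges ?K" for g
  proof -
    obtain v where v: "v \<in> g" "v \<in> verts ?H"
      using meet[OF g] by blast
    obtain f where "f \<in> ?F" "v \<in> f"
      using subsetD[OF cov v(2)] by (rule UnionE)
    then show ?thesis
      using v(1) by (intro bexI[of _ f]) auto
  qed
  then show ?thesis
    unfolding edge_dominating_set_def using FK by (meson DiffD1)
qed

text \<open>Old edges keep their choice and every new edge chooses its new end.\<close>

lemma attach_vertices_endpoint_choice:
  assumes G: "finite_simple_graph G" and fresh: "\<And>e. Mid k e \<notin> verts G"
    and c: "\<And>e. e \<in> edges G \<Longrightarrow> c e \<in> e" and surj: "verts G \<subseteq> c ` edges G"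
  shows "\<exists>c'. (\<forall>e\<in>edges (attach_vertices k G). c' e \<in> e) \<and>
    verts (attach_vertices k G) \<subseteq> c' ` edges (attach_vertices k G)"
proof -
  \<comment> \<open>For a new edge \<open>f\<close> the set \<open>f - verts G\<close> is a
    singleton, so \<open>SOME\<close> has only one possible value.\<close>
  define c' where "c' f = (if f \<in> edges G then c f else (SOME w. w \<in> f - verts G))" for f
  have *: "apex k e \<notin> verts G" for e
    using fresh by (simp add: apex_def)
  have new: "c' {u, apex k e} = apex k e" if "e \<in> edges G" "u \<in> e" for u e
  proof -
    have "{u, apex k e} - verts G = {apex k e}" "{u, apex k e} \<notin> edges G"
      using that * simple_graph_edge_subset[OF G] by blast+
    then show ?thesis
      by (simp add: c'_def)
  qed
  have old: "c' e = c e" if "e \<in> edges G" for e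
    using that by (simp add: c'_def)
  have "\<forall>e\<in>edges (attach_vertices k G). c' e \<in> e"
    using new old c by (auto simp: edges_attach_vertices[OF G])
  moreover have "v \<in> c' ` edges (attach_vertices k G)" if "v \<in> verts (attach_vertices k G)" for v
  proof (cases "v \<in> verts G")
    case True
    then obtain e where "e \<in> edges G" "v = c e"
      using surj by blast
    then show ?thesis
      using old by (auto simp: edges_attach_vertices[OF G] intro!: image_eqI[of _ _ e])
  next
    case False
    then obtain e where e: "e \<in> edges G" "v = apex k e"
      using \<open>v \<in> verts (attach_vertices k G)\<close> by (auto simp: verts_attach_vertices[OF G])
    obtain u where u: "u \<in> e"
      using simple_graph_edge_nonempty[OF G e(1)] by blast
    have "{u, apex k e} \<in> edges (attach_vertices k G)"
      using e(1) u by (auto simp: edges_attach_vertices[OF G])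
    then show ?thesis
      using new[OF e(1) u] e(2) by (metis imageI)
  qed
  ultimately show ?thesis
    by blast
qed

section \<open>Application to the webs\<close>

lemma web_fresh: "k > n \<Longrightarrow> Mid k e \<notin> verts (pseudofractal_web n)"
  using web_vertex_generation by fastforce

lemma web_endpoint_choice:
  "\<exists>c. (\<forall>e\<in>edges (pseudofractal_web (Suc n)). c e \<in> e) \<and>
    verts (pseudofractal_web (Suc n)) \<subseteq> c ` edges (pseudofractal_web (Suc n))"
proof (induction n)
  case 0
  \<comment> \<open>A cyclic orientation of the triangle; the last branch serves
    \<open>{Corner 1, Corner 2}\<close>.\<close>
  let ?c = "\<lambda>e. if e = {Corner 0, Corner 1} then Corner 0
    else if e = {Corner 0, Corner 2} then Corner 2 else Corner 1"
  show ?case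
    by (rule exI[of _ ?c]) (simp add: complete_graph_triangle doubleton_eq_iff)
next
  case (Suc n)
  then obtain c where "\<And>e. e \<in> edges (pseudofractal_web (Suc n)) \<Longrightarrow> c e \<in> e"
    "verts (pseudofractal_web (Suc n)) \<subseteq> c ` edges (pseudofractal_web (Suc n))"
    by blast
  moreover have "finite_simple_graph (pseudofractal_web (Suc n))"
    using pseudofractal_web_simple_card by blast
  moreover have "Mid (Suc (Suc n)) e \<notin> verts (pseudofractal_web (Suc n))" for e
    by (simp add: web_fresh)
  ultimately show ?case
    unfolding pseudofractal_web.simps using attach_vertices_endpoint_choice by blast
qed

theorem theorem1:
  fixes n :: nat
  assumes "n \<ge> 3"
  shows "edge_domination_number (pseudofractal_web n) = 3 ^ (n - 2)"
proof -
  \<comment> \<open>The bound \<open>n \<ge> 3\<close> keeps the index \<open>n - 2\<close> of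
    \<open>?G\<close> away from the dummy graph at 0.\<close>
  obtain i where n: "n = Suc (Suc (Suc i))"
    using assms by (auto simp: numeral_3_eq_3 Suc_le_eq less_iff_Suc_add)
  let ?G = "pseudofractal_web (Suc i)"
  have G: "finite_simple_graph ?G" and card: "card (edges ?G) = 3 ^ (n - 2)"
    using pseudofractal_web_simple_card[of i] by (auto simp: n)
  have K: "pseudofractal_web n = attach_vertices n (attach_vertices (n - 1) ?G)"
    by (simp add: n)
  have fresh: "Mid (n - 1) e \<notin> verts ?G" for e
    by (simp add: n web_fresh)
  have fresh': "Mid n e \<notin> verts (attach_vertices (n - 1) ?G)" for e
    using web_fresh[of "Suc (Suc i)" n e] by (simp add: n)
  have lower: "3 ^ (n - 2) \<le> card F" if "edge_dominating_set (pseudofractal_web n) F" for F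
    using edge_dominating_set_lower[OF G fresh fresh' that[unfolded K]] unfolding card .
  obtain c where "\<And>e. e \<in> edges ?G \<Longrightarrow> c e \<in> e" "verts ?G \<subseteq> c ` edges ?G"
    using web_endpoint_choice[of i] by metis
  then have F: "edge_dominating_set (pseudofractal_web n)
      ((\<lambda>e. {c e, apex (n - 1) e}) ` edges ?G)" (is "edge_dominating_set _ ?F")
    unfolding K by (intro edge_dominating_set_upper[OF G fresh])
  \<comment> \<open>The lower bound applied to \<open>?F\<close> itself supplies the reverse
    inequality, in place of an injectivity argument.\<close>
  have "card ?F \<le> 3 ^ (n - 2)"
    using card_image_le[OF simple_graph_finite_edges[OF G]] unfolding card[symmetric] .
  then have "card ?F = 3 ^ (n - 2)"
    using lower[OF F] by simp
  then show ?thesis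
    unfolding edge_domination_number_def using F lower by (intro Least_equality) auto
qed

end
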